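(* Let $m$ be an integer with $2m+1>5$, and let $\mathcal{R}_{2m+1}$ be the set of regular $(2m+1)$-tournaments up to isomorphism. For $T\in\mathcal{R}_{2m+1}$, the value $H_4(T)$ is the minimum of $H_4$ on $\mathcal{R}_{2m+1}$ if and only if $T$ is isomorphic to the consecutive rotational $(2m+1)$-tournament.
   Context: An $n$-tournament is a directed graph on $n$ vertices such that for each pair of distinct vertices $x,y$ exactly one of the arcs $x\to y$, $y\to x$ is present (no loops). It is regular if every vertex has out-degree $\frac{n-1}{2}$. The normalized Laplacian of an $n$-tournament $T$ is $\overline{L}_T=\binom{n}{2}^{-1}(D-A)$, where $A$ is the adjacency matrix ($A(i,j)=1$ if $v_i\to v_j$, else $0$) and $D$ is the diagonal matrix of out-degrees; $\Lambda_T$ is its spectrum (multiset of complex eigenvalues with algebraic multiplicity). The Rényi $4$-entropy is $H_4(T)=-\frac13\log_2\left(\sum_{\lambda\in\Lambda_T}\lambda^4\right)$. For $n=2m+1$, the consecutive rotational $n$-tournament has vertex set $\{0,1,\dots,n-1\}$ and arcs $i\to j$ exactly when $j-i$ is congruent modulo $n$ to an element of $\{1,2,\dots,m\}$. *)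

theory Defs
  imports
    Complex_Main
    "HOL-Computational_Algebra.Polynomial"
    "HOL-Number_Theory.Cong"
    "Jordan_Normal_Form.Char_Poly"
    "Graph_Theory.Graph_Theory"
begin

definition tournament :: "nat \<Rightarrow> 'a pair_pre_digraph \<Rightarrow> bool" where
  "tournament n T \<longleftrightarrow> pair_digraph T \<and> card (pverts T) = n \<and>
     (\<forall>x\<in>pverts T. \<forall>y\<in>pverts T. x \<noteq> y \<longrightarrow> ((x, y) \<in> parcs T) \<noteq> ((y, x) \<in> parcs T))"

definition regular_tournament :: "nat \<Rightarrow> 'a pair_pre_digraph \<Rightarrow> bool" where
  "regular_tournament n T \<longleftrightarrow> tournament n T \<and>
     (\<forall>v\<in>pverts T. real (out_degree T v) = (real n - 1) / 2)"

definition consecutive_rotational :: "nat \<Rightarrow> nat pair_pre_digraph" where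
  "consecutive_rotational m =
     \<lparr>pverts = {0..<2 * m + 1},
      parcs = {(i, j). i < 2 * m + 1 \<and> j < 2 * m + 1 \<and>
        (\<exists>d\<in>{1..m}. [int j - int i = int d] (mod int (2 * m + 1)))}\<rparr>"

text \<open>The matrices of a digraph refer to an enumeration \<open>vs\<close> of its vertices.\<close>

definition adjacency_matrix :: "'a list \<Rightarrow> 'a pair_pre_digraph \<Rightarrow> complex mat" where
  "adjacency_matrix vs T = mat (length vs) (length vs)
     (\<lambda>(i, j). if (vs ! i, vs ! j) \<in> parcs T then 1 else 0)"

definition out_degree_matrix :: "'a list \<Rightarrow> 'a pair_pre_digraph \<Rightarrow> complex mat" where
  "out_degree_matrix vs T = mat (length vs) (length vs)
     (\<lambda>(i, j). if i = j then of_nat (out_degree T (vs ! i)) else 0)"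

definition normalized_laplacian :: "'a list \<Rightarrow> 'a pair_pre_digraph \<Rightarrow> complex mat" where
  "normalized_laplacian vs T =
     inverse (of_nat (card (pverts T) choose 2)) \<cdot>\<^sub>m (out_degree_matrix vs T - adjacency_matrix vs T)"

definition enumerates :: "'a list \<Rightarrow> 'a pair_pre_digraph \<Rightarrow> bool" where
  "enumerates vs T \<longleftrightarrow> distinct vs \<and> set vs = pverts T"

text \<open>
  The eigenvalues with algebraic multiplicity. The choice of the enumeration is immaterial, see
  \<open>laplacian_spectrum_eq\<close> below, and the spectrum is invariant under isomorphism, see
  \<open>laplacian_spectrum_iso\<close>.
\<close>

definition laplacian_spectrum :: "'a pair_pre_digraph \<Rightarrow> complex multiset" where
  "laplacian_spectrum T =
     proots (char_poly (normalized_laplacian (SOME vs. enumerates vs T) T))"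

text \<open>
  The matrix is real, so its spectrum is closed under conjugation and the sum below is a real
  number; \<open>Re\<close> only changes its type.
\<close>

definition renyi_entropy_4 :: "'a pair_pre_digraph \<Rightarrow> real" where
  "renyi_entropy_4 T = - (1 / 3) * log 2 (Re (\<Sum>z\<in>#laplacian_spectrum T. z ^ 4))"

lemma char_poly_reindex:
  fixes l :: "'a \<Rightarrow> 'a \<Rightarrow> complex"
  assumes d: "distinct vs" "distinct ws" and s: "set vs = set ws" and n: "n = length vs"
  shows "char_poly (mat n n (\<lambda>(i, j). l (vs ! i) (vs ! j))) =
         char_poly (mat n n (\<lambda>(i, j). l (ws ! i) (ws ! j)))" (is "char_poly ?A = char_poly ?B")
proof -
  have n': "length ws = n" using d s n by (metis distinct_card)
  define P where "P = mat n n (\<lambda>(i, j). if vs ! i = ws ! j then 1 else (0::complex))"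
  define Q where "Q = mat n n (\<lambda>(i, j). if ws ! i = vs ! j then 1 else (0::complex))"
  have one: "(\<Sum>k = 0..<n. if us ! k = x then f k else 0) = f k0"
    if "distinct us" "length us = n" "k0 < n" "us ! k0 = x" for us :: "'a list" and x and f :: "nat \<Rightarrow> complex" and k0
  proof -
    have "(\<Sum>k = 0..<n. if us ! k = x then f k else 0) = (\<Sum>k = 0..<n. if k = k0 then f k else 0)"
      using that by (intro sum.cong) (auto simp: nth_eq_iff_index_eq)
    then show ?thesis using that by simp
  qed
  have vw: "\<exists>k<n. ws ! k = vs ! i" if "i < n" for i
    using that s n n' by (metis in_set_conv_nth nth_mem)
  have wv: "\<exists>k<n. vs ! k = ws ! i" if "i < n" for i
    using that s n n' by (metis in_set_conv_nth nth_mem)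
  have PQ: "P * Q = 1\<^sub>m n"
  proof (rule eq_matI)
    fix i j assume "i < dim_row (1\<^sub>m n)" "j < dim_col (1\<^sub>m n)"
    then have ij: "i < n" "j < n" by auto
    obtain k0 where k0: "k0 < n" "ws ! k0 = vs ! i" using vw ij by blast
    have "(P * Q) $$ (i, j) = (\<Sum>k = 0..<n. if ws ! k = vs ! i then (if ws ! k = vs ! j then 1 else 0) else 0)"
      using ij unfolding P_def Q_def by (auto simp: scalar_prod_def intro!: sum.cong)
    also have "\<dots> = (if ws ! k0 = vs ! j then 1 else 0)"
      using one[OF d(2) n' k0, of "\<lambda>k. if ws ! k = vs ! j then 1 else 0"] .
    finally show "(P * Q) $$ (i, j) = 1\<^sub>m n $$ (i, j)"
      using k0 ij d n by (auto simp: nth_eq_iff_index_eq)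
  qed (auto simp: P_def Q_def)
  have QP: "Q * P = 1\<^sub>m n"
  proof (rule eq_matI)
    fix i j assume "i < dim_row (1\<^sub>m n)" "j < dim_col (1\<^sub>m n)"
    then have ij: "i < n" "j < n" by auto
    obtain k0 where k0: "k0 < n" "vs ! k0 = ws ! i" using wv ij by blast
    have "(Q * P) $$ (i, j) = (\<Sum>k = 0..<n. if vs ! k = ws ! i then (if vs ! k = ws ! j then 1 else 0) else 0)"
      using ij unfolding P_def Q_def by (auto simp: scalar_prod_def intro!: sum.cong)
    also have "\<dots> = (if vs ! k0 = ws ! j then 1 else 0)"
      using one[OF d(1) n[symmetric] k0, of "\<lambda>k. if vs ! k = ws ! j then 1 else 0"] .
    finally show "(Q * P) $$ (i, j) = 1\<^sub>m n $$ (i, j)"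
      using k0 ij d n' by (auto simp: nth_eq_iff_index_eq)
  qed (auto simp: P_def Q_def)
  have AP: "?A * P = P * ?B"
  proof (rule eq_matI)
    fix i j assume "i < dim_row (P * ?B)" "j < dim_col (P * ?B)"
    then have ij: "i < n" "j < n" by (auto simp: P_def)
    obtain k0 where k0: "k0 < n" "vs ! k0 = ws ! j" using wv ij by blast
    obtain k1 where k1: "k1 < n" "ws ! k1 = vs ! i" using vw ij by blast
    have "(?A * P) $$ (i, j) = (\<Sum>k = 0..<n. if vs ! k = ws ! j then l (vs ! i) (vs ! k) else 0)"
      using ij unfolding P_def by (auto simp: scalar_prod_def intro!: sum.cong)
    also have "\<dots> = l (vs ! i) (ws ! j)"
      using one[OF d(1) n[symmetric] k0, of "\<lambda>k. l (vs ! i) (vs ! k)"] k0 by simp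
    also have "\<dots> = (\<Sum>k = 0..<n. if ws ! k = vs ! i then l (ws ! k) (ws ! j) else 0)"
      using one[OF d(2) n' k1, of "\<lambda>k. l (ws ! k) (ws ! j)"] k1 by simp
    also have "\<dots> = (P * ?B) $$ (i, j)"
      using ij unfolding P_def by (auto simp: scalar_prod_def intro!: sum.cong)
    finally show "(?A * P) $$ (i, j) = (P * ?B) $$ (i, j)" .
  qed (auto simp: P_def)
  have c: "?A \<in> carrier_mat n n" "?B \<in> carrier_mat n n" "P \<in> carrier_mat n n" "Q \<in> carrier_mat n n"
    by (auto simp: P_def Q_def)
  have "P * ?B * Q = ?A * P * Q" by (simp only: AP)
  also have "\<dots> = ?A * (P * Q)" using c by (intro assoc_mult_mat)
  also have "\<dots> = ?A" using c PQ by simp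
  finally have "similar_mat ?A ?B"
    using c PQ QP by (intro similar_matI[of _ _ P Q n]) (simp_all only: insert_subset empty_subsetI simp_thms)
  then show ?thesis by (rule char_poly_similar)
qed

lemma normalized_laplacian_entries:
  assumes "distinct vs"
  shows "normalized_laplacian vs T = mat (length vs) (length vs)
    (\<lambda>(i, j). (\<lambda>x y. inverse (of_nat (card (pverts T) choose 2)) *
      ((if x = y then of_nat (out_degree T x) else 0) - (if (x, y) \<in> parcs T then 1 else 0)))
      (vs ! i) (vs ! j))"
  using assms unfolding normalized_laplacian_def out_degree_matrix_def adjacency_matrix_def
  by (intro eq_matI) (auto simp: nth_eq_iff_index_eq)

lemma laplacian_spectrum_eq:
  assumes vs: "enumerates vs T"
  shows "laplacian_spectrum T = proots (char_poly (normalized_laplacian vs T))"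
proof -
  define ws where "ws = (SOME vs. enumerates vs T)"
  have ws: "enumerates ws T" unfolding ws_def using vs by (rule someI)
  have l: "length ws = length vs"
    using vs ws unfolding enumerates_def by (metis distinct_card)
  have "char_poly (normalized_laplacian ws T) = char_poly (normalized_laplacian vs T)"
    using vs ws unfolding enumerates_def
    by (simp add: normalized_laplacian_entries l del: mult_eq_0_iff)
       (rule char_poly_reindex; simp add: l)
  then show ?thesis by (simp add: laplacian_spectrum_def ws_def)
qed

lemma digraph_iso_pairD:
  fixes T :: "'a pair_pre_digraph" and T' :: "'b pair_pre_digraph"
  assumes "digraph_iso T T'"
  obtains f where "pair_wf_digraph T" "inj_on f (pverts T)" "pverts T' = f ` pverts T"
    "parcs T' = (\<lambda>(x, y). (f x, f y)) ` parcs T"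
proof -
  obtain h where h: "pre_digraph.digraph_isomorphism (with_proj T) h"
    and T': "with_proj T' = app_iso h (with_proj T)"
    using assms unfolding digraph_iso_def by blast
  have t: "iso_tail h = fst" "iso_head h = snd"
    "pverts T' = iso_verts h ` pverts T" "parcs T' = iso_arcs h ` parcs T"
    using arg_cong[OF T', of tail] arg_cong[OF T', of head] arg_cong[OF T', of verts]
      arg_cong[OF T', of arcs] by simp_all
  have wf: "wf_digraph (with_proj T)"
    using h by (simp add: pre_digraph.digraph_isomorphism_def)
  have "iso_arcs h a = (iso_verts h (fst a), iso_verts h (snd a))" if "a \<in> parcs T" for a
    using h that by (simp add: pre_digraph.digraph_isomorphism_def t prod_eq_iff)
  then have "parcs T' = (\<lambda>(x, y). (iso_verts h x, iso_verts h y)) ` parcs T"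
    unfolding t by (auto simp: image_iff) (metis fst_conv snd_conv)+
  moreover have "inj_on (iso_verts h) (pverts T)"
    using h by (simp add: pre_digraph.digraph_isomorphism_def)
  moreover have "pair_wf_digraph T"
    using wf by (auto simp: wf_digraph_def pair_wf_digraph_def)
  ultimately show thesis using that t by blast
qed

lemma laplacian_spectrum_iso:
  fixes T :: "'a pair_pre_digraph" and T' :: "'b pair_pre_digraph"
  assumes fin: "finite (pverts T)" and iso: "digraph_iso T T'"
  shows "laplacian_spectrum T = laplacian_spectrum T'"
proof -
  obtain f where wf: "pair_wf_digraph T" and inj: "inj_on f (pverts T)"
    and V: "pverts T' = f ` pverts T" and E: "parcs T' = (\<lambda>(x, y). (f x, f y)) ` parcs T"
    using iso by (rule digraph_iso_pairD)
  obtain vs where vs: "distinct vs" "set vs = pverts T"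
    using fin finite_distinct_list by blast
  have sub: "x \<in> pverts T" "y \<in> pverts T" if "(x, y) \<in> parcs T" for x y
    using wf that by (auto simp: pair_wf_digraph_def)
  have E': "(f x, f y) \<in> parcs T' \<longleftrightarrow> (x, y) \<in> parcs T" if "x \<in> pverts T" "y \<in> pverts T" for x y
  proof
    assume "(f x, f y) \<in> parcs T'"
    then obtain u v where uv: "(u, v) \<in> parcs T" "f x = f u" "f y = f v" unfolding E by auto
    then have "x = u" "y = v" using inj_onD[OF inj] sub that by blast+
    then show "(x, y) \<in> parcs T" using uv by simp
  qed (force simp: E)
  have deg: "out_degree T' (f x) = out_degree T x" if x: "x \<in> pverts T" for x
  proof -
    have "out_arcs T' (f x) = (\<lambda>(x, y). (f x, f y)) ` out_arcs T x"
    proof (intro equalityI subsetI)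
      fix a assume "a \<in> out_arcs T' (f x)"
      then obtain u v where uv: "(u, v) \<in> parcs T" "a = (f u, f v)" "f u = f x"
        unfolding out_arcs_def by (auto simp: E)
      then have "u = x" using inj_onD[OF inj] sub x by blast
      then show "a \<in> (\<lambda>(x, y). (f x, f y)) ` out_arcs T x"
        using uv by (force simp: out_arcs_def)
    qed (force simp: out_arcs_def E)
    moreover have "inj_on (\<lambda>(x, y). (f x, f y)) (out_arcs T x)"
      using sub inj_onD[OF inj] by (auto simp: inj_on_def out_arcs_def)
    ultimately show ?thesis by (simp add: out_degree_def card_image)
  qed
  have c: "card (pverts T') = card (pverts T)" by (simp add: V card_image inj)
  have mem: "vs ! i \<in> pverts T" if "i < length vs" for i
    using that vs nth_mem by blast
  have "normalized_laplacian (map f vs) T' = normalized_laplacian vs T"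
    unfolding normalized_laplacian_def out_degree_matrix_def adjacency_matrix_def c
    by (intro eq_matI) (auto simp: mem E' deg)
  moreover have "enumerates (map f vs) T'" "enumerates vs T"
    using vs inj by (auto simp: enumerates_def V distinct_map)
  ultimately show ?thesis by (simp add: laplacian_spectrum_eq)
qed

end

theory Submission
  imports Defs "Jordan_Normal_Form.Schur_Decomposition"
begin

text \<open>
  In a regular tournament the out-degree matrix is scalar, so the sum of the fourth powers of the
  Laplacian eigenvalues is a polynomial in \<open>m\<close> and in the traces of the powers of the adjacency
  matrix. The traces of the first three powers are determined by \<open>m\<close>, so minimising the entropy
  means maximising the number of closed walks of length four. Adding a vertex to a cyclic triangle
  gives a 4-cycle unless this vertex dominates the whole triangle or is dominated by it; hence the
  maximum is attained exactly when no such configuration exists, that is, when all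
  out-neighbourhoods and all in-neighbourhoods are transitive.

  In such a tournament let \<open>s v\<close> be the source of the out-neighbourhood of \<open>v\<close>. Passing from \<open>v\<close> to
  \<open>s v\<close> removes \<open>s v\<close> from the out-neighbourhood and appends a sink, so the out-neighbours of \<open>v\<close>
  are \<open>s v, \<dots>, s\<^sup>m v\<close> in this order, and \<open>i \<mapsto> s\<^sup>i v\<close> is an isomorphism from the consecutive
  rotational tournament.
\<close>

section \<open>Power sums of eigenvalues\<close>

lemma trace_mult_commute:
  fixes A B :: "'a::comm_semiring_0 mat"
  assumes "A \<in> carrier_mat n n" "B \<in> carrier_mat n n"
  shows "(\<Sum>i<n. (A * B) $$ (i, i)) = (\<Sum>i<n. (B * A) $$ (i, i))"
proof -
  have "(\<Sum>i<n. (A * B) $$ (i, i)) = (\<Sum>i<n. \<Sum>j<n. A $$ (i, j) * B $$ (j, i))"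
    using assms by (auto simp: scalar_prod_def atLeast0LessThan intro!: sum.cong)
  also have "\<dots> = (\<Sum>j<n. \<Sum>i<n. B $$ (j, i) * A $$ (i, j))"
    by (subst sum.swap) (simp add: mult.commute)
  also have "\<dots> = (\<Sum>i<n. (B * A) $$ (i, i))"
    using assms by (auto simp: scalar_prod_def atLeast0LessThan intro!: sum.cong)
  finally show ?thesis .
qed

lemma trace_similar_mat_wit:
  fixes A B :: "'a::comm_semiring_1 mat"
  assumes A: "A \<in> carrier_mat n n" and w: "similar_mat_wit A B P Q"
  shows "(\<Sum>i<n. A $$ (i, i)) = (\<Sum>i<n. B $$ (i, i))"
proof -
  note W = similar_mat_witD2[OF A w]
  have "(\<Sum>i<n. A $$ (i, i)) = (\<Sum>i<n. (P * (B * Q)) $$ (i, i))"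
    using W(3) assoc_mult_mat[OF W(6) W(5) W(7)] by simp
  also have "\<dots> = (\<Sum>i<n. (B * Q * P) $$ (i, i))"
    using W(5-7) by (intro trace_mult_commute) auto
  also have "B * Q * P = B"
    using assoc_mult_mat[OF W(5) W(7) W(6)] W(2) right_mult_one_mat[OF W(5)] by simp
  finally show ?thesis .
qed

lemma upper_triangular_mult:
  fixes A B :: "'a::comm_semiring_1 mat"
  assumes c: "A \<in> carrier_mat n n" "B \<in> carrier_mat n n"
    and u: "upper_triangular A" "upper_triangular B"
  shows "upper_triangular (A * B)"
    and "i < n \<Longrightarrow> (A * B) $$ (i, i) = A $$ (i, i) * B $$ (i, i)"
proof -
  have e: "(A * B) $$ (i, j) = (\<Sum>k<n. A $$ (i, k) * B $$ (k, j))" if "i < n" "j < n" for i j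
    using c that by (auto simp: scalar_prod_def atLeast0LessThan intro!: sum.cong)
  have z: "A $$ (i, k) * B $$ (k, j) = 0" if "i < n" "k < n" "j < i \<or> j = i \<and> k \<noteq> i" for i j k
  proof (cases "k < i")
    case True
    then show ?thesis using c u that by (simp add: upper_triangularD)
  next
    case False
    then have "j < k" using that by auto
    then show ?thesis using c u that by (simp add: upper_triangularD)
  qed
  show "upper_triangular (A * B)"
    using c by (intro upper_triangularI) (auto simp: e simp del: index_mult_mat(1) intro!: sum.neutral z)
  show "(A * B) $$ (i, i) = A $$ (i, i) * B $$ (i, i)" if i: "i < n"
  proof -
    have "(\<Sum>k<n. A $$ (i, k) * B $$ (k, i)) = (\<Sum>k<n. if k = i then A $$ (i, i) * B $$ (i, i) else 0)"
      using z[OF i] by (intro sum.cong) auto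
    then show ?thesis using i by (simp add: e)
  qed
qed

lemma upper_triangular_pow:
  fixes A :: "'a::comm_semiring_1 mat"
  assumes c: "A \<in> carrier_mat n n" and u: "upper_triangular A"
  shows "upper_triangular (A ^\<^sub>m k) \<and> (\<forall>i<n. (A ^\<^sub>m k) $$ (i, i) = (A $$ (i, i)) ^ k)"
proof (induction k)
  case 0
  then show ?case using c by simp
next
  case (Suc k)
  then show ?case
    using upper_triangular_mult[of "A ^\<^sub>m k" n A] c u by (simp add: mult.commute)
qed

text \<open>Schur decomposition conjugates \<open>A\<close> to a triangular matrix \<open>B\<close>.
  The same \<open>P\<close> and \<open>Q\<close> triangularise the powers of \<open>A\<close> and
  the scaled shifts, so one list \<open>es\<close>, the diagonal of \<open>B\<close>, serves all
  \<open>k\<close>, \<open>c\<close> and \<open>d\<close> at once.\<close>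

lemma spectrum_shifted_scaled:
  fixes A :: "complex mat"
  assumes A: "A \<in> carrier_mat n n"
  obtains es where "length es = n"
    "\<And>k. (\<Sum>e\<leftarrow>es. e ^ k) = (\<Sum>i<n. (A ^\<^sub>m k) $$ (i, i))"
    "\<And>c d. proots (char_poly (c \<cdot>\<^sub>m (d \<cdot>\<^sub>m 1\<^sub>m n - A))) = mset (map (\<lambda>e. c * (d - e)) es)"
proof -
  obtain es where es: "char_poly A = (\<Prod>a\<leftarrow>es. [:- a, 1:])" and len: "length es = n"
    using char_poly_factorized[OF A] by blast
  obtain B P Q where "schur_decomposition A es = (B, P, Q)" by (metis prod_cases3)
  from schur_decomposition[OF A es this]
  have w: "similar_mat_wit A B P Q" and u: "upper_triangular B" and diag: "diag_mat B = es" by auto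
  note W = similar_mat_witD2[OF A w]
  have B: "B \<in> carrier_mat n n" using W by simp
  have diag_i: "map (\<lambda>i. B $$ (i, i)) [0..<n] = es" using diag B by (simp add: diag_mat_def)
  have sums: "(\<Sum>e\<leftarrow>es. f e) = (\<Sum>i<n. f (B $$ (i, i)))" for f :: "complex \<Rightarrow> complex"
    unfolding diag_i[symmetric] by (simp add: o_def interv_sum_list_conv_sum_set_nat atLeast0LessThan)
  have "(\<Sum>e\<leftarrow>es. e ^ k) = (\<Sum>i<n. (A ^\<^sub>m k) $$ (i, i))" for k
    using trace_similar_mat_wit[OF _ similar_mat_wit_pow[OF w, of k], of n] A
      upper_triangular_pow[OF B u, of k] by (simp add: sums)
  moreover have "proots (char_poly (c \<cdot>\<^sub>m (d \<cdot>\<^sub>m 1\<^sub>m n - A))) = mset (map (\<lambda>e. c * (d - e)) es)" for c d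
  proof -
    let ?S = "\<lambda>X. c \<cdot>\<^sub>m (d \<cdot>\<^sub>m 1\<^sub>m n - X)"
    have D: "d \<cdot>\<^sub>m 1\<^sub>m n \<in> carrier_mat n n" and DB: "d \<cdot>\<^sub>m 1\<^sub>m n - B \<in> carrier_mat n n"
      using W(5) by auto
    have "P * ?S B * Q = c \<cdot>\<^sub>m (P * (d \<cdot>\<^sub>m 1\<^sub>m n - B) * Q)"
      using mult_smult_distrib[OF W(6) DB] mult_smult_assoc_mat[OF mult_carrier_mat[OF W(6) DB] W(7)]
      by simp
    also have "P * (d \<cdot>\<^sub>m 1\<^sub>m n - B) * Q = P * (d \<cdot>\<^sub>m 1\<^sub>m n) * Q - P * B * Q"
      using mult_minus_distrib_mat[OF W(6) D W(5)]
        minus_mult_distrib_mat[OF mult_carrier_mat[OF W(6) D] mult_carrier_mat[OF W(6) W(5)] W(7)]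
      by simp
    also have "P * (d \<cdot>\<^sub>m 1\<^sub>m n) * Q = d \<cdot>\<^sub>m 1\<^sub>m n"
      using mult_smult_distrib[OF W(6) one_carrier_mat] mult_smult_assoc_mat[OF W(6) W(7)]
        right_mult_one_mat[OF W(6)] W(1) by simp
    finally have "?S A = P * ?S B * Q" by (simp only: W(3))
    then have "similar_mat (?S A) (?S B)"
      using W(1,2,4-7) by (intro similar_matI[of _ _ P Q n]) auto
    then have "char_poly (?S A) = char_poly (?S B)" by (rule char_poly_similar)
    also have "\<dots> = (\<Prod>a\<leftarrow>diag_mat (?S B). [:- a, 1:])"
      using B u by (intro char_poly_upper_triangular[of _ n] upper_triangularI) (auto simp: upper_triangularD)
    also have "diag_mat (?S B) = map (\<lambda>e. c * (d - e)) es"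
      using B unfolding diag_i[symmetric] by (simp add: diag_mat_def)
    also have "proots (\<Prod>a\<leftarrow>xs. [:- a, 1:]) = mset xs" for xs :: "complex list"
    proof (induction xs)
      case (Cons a xs)
      have "(\<Prod>a\<leftarrow>xs. [:- a, 1:]) \<noteq> 0" by (auto simp: prod_list_zero_iff)
      then show ?case using Cons by (simp add: proots_mult del: mult_pCons_left)
    qed simp
    finally show ?thesis .
  qed
  ultimately show thesis using that len by blast
qed

section \<open>Closed walks in regular tournaments\<close>

text \<open>Arcs are supported on \<open>V\<close>, so \<open>{y. E x y}\<close> is the
  out-neighbourhood without intersecting with \<open>V\<close>.\<close>

locale regular_tournament_rel =
  fixes V :: "'a set" and E :: "'a \<Rightarrow> 'a \<Rightarrow> bool" and m :: nat
  assumes finite_V: "finite V"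
    and card_V: "card V = 2 * m + 1"
    and E_in: "E x y \<Longrightarrow> x \<in> V \<and> y \<in> V"
    and E_irrefl: "\<not> E x x"
    and E_tournament: "x \<in> V \<Longrightarrow> y \<in> V \<Longrightarrow> x \<noteq> y \<Longrightarrow> E x y \<noteq> E y x"
    and out_card: "x \<in> V \<Longrightarrow> card {y. E x y} = m"
begin

abbreviation arc :: "'a \<Rightarrow> 'a \<Rightarrow> real" where
  "arc x y \<equiv> of_bool (E x y)"

definition closed_walks3 :: real where
  "closed_walks3 = (\<Sum>x\<in>V. \<Sum>y\<in>V. \<Sum>z\<in>V. arc x y * arc y z * arc z x)"

text \<open>Without loops and 2-cycles the four vertices of such a walk are distinct, so every
  4-cycle is counted four times, once per starting vertex.\<close>

definition closed_walks4 :: real where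
  "closed_walks4 = (\<Sum>x\<in>V. \<Sum>y\<in>V. \<Sum>z\<in>V. \<Sum>w\<in>V. arc x y * arc y z * arc z w * arc w x)"

text \<open>The defect that separates \<open>closed_walks4\<close> from its maximum; each pair of a
  cyclic triangle and a vertex \<open>v\<close> is counted three times.\<close>

definition dominated :: real where
  "dominated = (\<Sum>v\<in>V. \<Sum>x\<in>V. \<Sum>y\<in>V. \<Sum>z\<in>V.
     arc x y * arc y z * arc z x * (arc v x * arc v y * arc v z + arc x v * arc y v * arc z v))"

lemma E_asym: "E x y \<Longrightarrow> \<not> E y x"
  using E_tournament E_in E_irrefl by metis

lemma E_total: "x \<in> V \<Longrightarrow> y \<in> V \<Longrightarrow> x \<noteq> y \<Longrightarrow> E x y \<or> E y x"
  using E_tournament by metis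

lemma out_subset: "{y. E x y} \<subseteq> V"
  using E_in by auto

lemma finite_out: "finite {y. E x y}"
  using out_subset finite_V by (rule finite_subset)

lemma sum_arc: "x \<in> V \<Longrightarrow> (\<Sum>y\<in>V. arc x y) = real m"
  using finite_V out_card Int_absorb1[OF out_subset] by simp

text \<open>A path \<open>x -> y -> z\<close> is completed either by \<open>z -> x\<close> to a
  cyclic triangle or by \<open>x -> z\<close> to a transitive one. The transitive triangles are
  counted by the pairs of out-neighbours of their source \<open>x\<close>.\<close>

lemma closed_walks3_eq: "closed_walks3 = (2 * real m + 1) * m * (m + 1) / 2"
proof -
  define t where "t = (\<Sum>x\<in>V. \<Sum>y\<in>V. \<Sum>z\<in>V. arc x y * arc y z * arc x z)"
  define n where "n = 2 * real m + 1"
  have n: "n = real (card V)" by (simp add: n_def card_V)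
  have "closed_walks3 + t = (\<Sum>x\<in>V. \<Sum>y\<in>V. \<Sum>z\<in>V. arc x y * arc y z)"
    unfolding closed_walks3_def t_def sum.distrib[symmetric]
  proof (intro sum.cong refl)
    fix x y z assume "x \<in> V" "y \<in> V" "z \<in> V"
    then show "arc x y * arc y z * arc z x + arc x y * arc y z * arc x z = arc x y * arc y z"
      using E_total[of x z] E_asym[of x z] E_asym[of x y] by auto
  qed
  also have "\<dots> = n * m * m"
    by (simp add: sum_distrib_left[symmetric] sum_distrib_right[symmetric] sum_arc n)
  finally have 1: "closed_walks3 + t = n * m * m" .
  \<comment> \<open>Exchanging \<open>y\<close> and \<open>z\<close> lets \<open>t + t\<close> cover
    both orientations of the arc between them; what remains is the number of ordered pairs of
    distinct out-neighbours of \<open>x\<close>.\<close>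
  have "t = (\<Sum>x\<in>V. \<Sum>y\<in>V. \<Sum>z\<in>V. arc x y * arc z y * arc x z)"
    unfolding t_def
    by (rule sum.cong[OF refl], rule trans[OF sum.swap]) (simp add: mult_ac)
  then have "t + t = (\<Sum>x\<in>V. \<Sum>y\<in>V. \<Sum>z\<in>V. arc x y * arc y z * arc x z + arc x y * arc z y * arc x z)"
    unfolding sum.distrib t_def by simp
  also have "\<dots> = (\<Sum>x\<in>V. \<Sum>y\<in>V. \<Sum>z\<in>V. arc x y * arc x z - (if z = y then arc x y else 0))"
  proof (intro sum.cong refl)
    fix x y z assume "x \<in> V" "y \<in> V" "z \<in> V"
    then show "arc x y * arc y z * arc x z + arc x y * arc z y * arc x z =
        arc x y * arc x z - (if z = y then arc x y else 0)"
      using E_total[of y z] E_asym[of y z] E_irrefl by auto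
  qed
  also have "\<dots> = n * m * m - n * m"
    by (simp add: sum_subtractf sum_distrib_left[symmetric] sum_distrib_right[symmetric]
        sum_arc finite_V n algebra_simps del: sum_of_bool_eq)
  finally have 2: "t + t = n * m * m - n * m" .
  from 1 2 show ?thesis unfolding n_def[symmetric] by (simp add: algebra_simps)
qed

text \<open>Double counting of cyclic triangles with a vertex \<open>v\<close> outside: unless
  \<open>v\<close> dominates the triangle or is dominated by it, \<open>v\<close> can be inserted
  into exactly one of its arcs, which yields a 4-cycle.\<close>

lemma closed_walks4_eq:
  "3 * closed_walks4 = 2 * (closed_walks3 * (2 * real m - 2) - dominated)"
proof -
  let ?S = "\<lambda>f. \<Sum>x\<in>V. \<Sum>y\<in>V. \<Sum>z\<in>V. \<Sum>v\<in>V. (f x y z v :: real)"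
  let ?C = "\<lambda>x y z. arc x y * arc y z * arc z x"
  define q where "q = ?S (\<lambda>x y z v. ?C x y z * (arc x v * arc v y))"
  have rot: "?S (\<lambda>x y z v. f y z x v) = ?S f" for f
  proof -
    have "?S (\<lambda>x y z v. f y z x v) = (\<Sum>y\<in>V. \<Sum>x\<in>V. \<Sum>z\<in>V. \<Sum>v\<in>V. f y z x v)" by (rule sum.swap)
    also have "\<dots> = ?S f" by (intro sum.cong refl sum.swap)
    finally show ?thesis .
  qed
  \<comment> \<open>By the cyclic symmetry of the triangle, insertions into its second and third arc
    are as many as into the first.\<close>
  have q': "?S (\<lambda>x y z v. ?C x y z * (arc y v * arc v z)) = q"
    using rot[of "\<lambda>x y z v. ?C x y z * (arc x v * arc v y)"] unfolding q_def by (simp add: mult_ac)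
  have q'': "?S (\<lambda>x y z v. ?C x y z * (arc z v * arc v x)) = q"
    using rot[of "\<lambda>x y z v. ?C x y z * (arc y v * arc v z)"] q' by (simp add: mult_ac)
  have dom: "dominated = ?S (\<lambda>x y z v. ?C x y z * (arc v x * arc v y * arc v z + arc x v * arc y v * arc z v))"
  proof -
    let ?g = "\<lambda>x y z v. ?C x y z * (arc v x * arc v y * arc v z + arc x v * arc y v * arc z v)"
    have "dominated = (\<Sum>x\<in>V. \<Sum>v\<in>V. \<Sum>y\<in>V. \<Sum>z\<in>V. ?g x y z v)"
      unfolding dominated_def by (rule sum.swap)
    also have "\<dots> = (\<Sum>x\<in>V. \<Sum>y\<in>V. \<Sum>v\<in>V. \<Sum>z\<in>V. ?g x y z v)"
      by (intro sum.cong refl sum.swap)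
    also have "\<dots> = ?S ?g"
      by (intro sum.cong refl sum.swap)
    finally show ?thesis .
  qed
  \<comment> \<open>Going once around a cyclic triangle, the direction of the arc to an outside vertex \<open>v\<close> is either
    constant or changes from out to in exactly once; \<open>q\<close> counts these changes.\<close>
  have "3 * q + dominated = ?S (\<lambda>x y z v. ?C x y z * (arc x v * arc v y)) +
      ?S (\<lambda>x y z v. ?C x y z * (arc y v * arc v z)) + ?S (\<lambda>x y z v. ?C x y z * (arc z v * arc v x)) +
      dominated"
    unfolding q' q'' by (simp add: q_def)
  also have "\<dots> = ?S (\<lambda>x y z v. ?C x y z *
      (1 - of_bool (v = x) - of_bool (v = y) - of_bool (v = z)))"
    unfolding dom sum.distrib[symmetric]
  proof (intro sum.cong refl)
    fix x y z v assume V: "x \<in> V" "y \<in> V" "z \<in> V" "v \<in> V"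
    show "?C x y z * (arc x v * arc v y) + ?C x y z * (arc y v * arc v z) + ?C x y z * (arc z v * arc v x)
        + ?C x y z * (arc v x * arc v y * arc v z + arc x v * arc y v * arc z v)
      = ?C x y z * (1 - of_bool (v = x) - of_bool (v = y) - of_bool (v = z))"
    proof (cases "E x y \<and> E y z \<and> E z x")
      case True
      then have n: "x \<noteq> y" "y \<noteq> z" "z \<noteq> x" "\<not> E y x" "\<not> E z y" "\<not> E x z"
        using E_irrefl E_asym by metis+
      show ?thesis
        using True n V E_irrefl[of x] E_irrefl[of y] E_irrefl[of z]
          E_tournament[of x v] E_tournament[of y v] E_tournament[of z v]
        by (cases "v = x"; cases "v = y"; cases "v = z"; cases "E x v"; cases "E y v"; cases "E z v") simp_all
    qed auto
  qed
  \<comment> \<open>There are \<open>2 * m + 1 - 3\<close> vertices outside a triangle.\<close>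
  also have "\<dots> = (\<Sum>x\<in>V. \<Sum>y\<in>V. \<Sum>z\<in>V. ?C x y z * (2 * real m - 2))"
  proof (intro sum.cong refl)
    fix x y z assume V: "x \<in> V" "y \<in> V" "z \<in> V"
    have "(\<Sum>v\<in>V. 1 - of_bool (v = x) - of_bool (v = y) - of_bool (v = z) :: real) = 2 * real m - 2"
      using V finite_V by (simp add: sum_subtractf card_V of_bool_def)
    then show "(\<Sum>v\<in>V. ?C x y z * (1 - of_bool (v = x) - of_bool (v = y) - of_bool (v = z)))
      = ?C x y z * (2 * real m - 2)" by (simp add: sum_distrib_left[symmetric])
  qed
  also have "\<dots> = closed_walks3 * (2 * real m - 2)"
    unfolding closed_walks3_def by (simp add: sum_distrib_right)
  finally have 1: "3 * q + dominated = closed_walks3 * (2 * real m - 2)" .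
  let ?W = "\<lambda>x v y z. arc x v * arc v y * arc y z * arc z x"
  \<comment> \<open>Replacing the arc \<open>x -> y\<close> by \<open>x -> v -> y\<close> turns the
    triangle into a 4-cycle, of which that arc is a chord.\<close>
  have w1: "q = ?S (\<lambda>x v y z. ?W x v y z * arc x y)"
  proof -
    have "q = (\<Sum>x\<in>V. \<Sum>y\<in>V. \<Sum>v\<in>V. \<Sum>z\<in>V. ?W x v y z * arc x y)"
      unfolding q_def
      by (rule sum.cong[OF refl], rule sum.cong[OF refl], rule trans[OF sum.swap]) (simp add: mult_ac)
    also have "\<dots> = ?S (\<lambda>x v y z. ?W x v y z * arc x y)"
      by (intro sum.cong refl sum.swap)
    finally show ?thesis .
  qed
  have w2: "?S (\<lambda>x v y z. ?W x v y z * arc y x) = q"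
  proof -
    \<comment> \<open>Adjacent exchanges move the order of summation from \<open>x v y z\<close> to
      \<open>y z x v\<close>, the rotation by two steps.\<close>
    have "?S (\<lambda>x v y z. ?W x v y z * arc y x) = ?S (\<lambda>v x y z. ?W x v y z * arc y x)" by (rule sum.swap)
    also have "\<dots> = ?S (\<lambda>v y x z. ?W x v y z * arc y x)" by (intro sum.cong refl sum.swap)
    also have "\<dots> = ?S (\<lambda>v y z x. ?W x v y z * arc y x)" by (intro sum.cong refl sum.swap)
    also have "\<dots> = ?S (\<lambda>y v z x. ?W x v y z * arc y x)" by (rule sum.swap)
    also have "\<dots> = ?S (\<lambda>y z v x. ?W x v y z * arc y x)" by (intro sum.cong refl sum.swap)
    also have "\<dots> = ?S (\<lambda>y z x v. ?W x v y z * arc y x)" by (intro sum.cong refl sum.swap)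
    finally show ?thesis by (simp add: w1 mult_ac)
  qed
  \<comment> \<open>Rotating a 4-cycle by two steps reverses the direction of its chord.\<close>
  have "closed_walks4 = ?S (\<lambda>x v y z. ?W x v y z * arc x y + ?W x v y z * arc y x)"
    unfolding closed_walks4_def
  proof (intro sum.cong refl)
    fix x v y z assume V: "x \<in> V" "v \<in> V" "y \<in> V" "z \<in> V"
    show "?W x v y z = ?W x v y z * arc x y + ?W x v y z * arc y x"
      using V E_total[of x y] E_asym[of x y] E_asym[of x v] by auto
  qed
  also have "\<dots> = q + q" unfolding sum.distrib w2 w1[symmetric] ..
  finally show ?thesis using 1 by simp
qed

lemma dominated_nonneg: "0 \<le> dominated"
  unfolding dominated_def by (intro sum_nonneg) auto

lemma dominated_eq_0_iff:
  "dominated = 0 \<longleftrightarrow> (\<forall>v x y z. E x y \<and> E y z \<and> E z x \<longrightarrow>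
     \<not> (E v x \<and> E v y \<and> E v z) \<and> \<not> (E x v \<and> E y v \<and> E z v))"
proof -
  have "dominated = 0 \<longleftrightarrow> (\<forall>v\<in>V. \<forall>x\<in>V. \<forall>y\<in>V. \<forall>z\<in>V.
     arc x y * arc y z * arc z x * (arc v x * arc v y * arc v z + arc x v * arc y v * arc z v) = 0)"
    unfolding dominated_def by (simp add: sum_nonneg_eq_0_iff sum_nonneg finite_V del: mult_eq_0_iff)
  also have "\<dots> \<longleftrightarrow> (\<forall>v x y z. E x y \<and> E y z \<and> E z x \<longrightarrow>
     \<not> (E v x \<and> E v y \<and> E v z) \<and> \<not> (E x v \<and> E y v \<and> E z v))"
    (is "?L \<longleftrightarrow> ?R")
  proof
    assume L: ?L
    show ?R
    proof (intro allI impI)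
      fix v x y z assume c: "E x y \<and> E y z \<and> E z x"
      show "\<not> (E v x \<and> E v y \<and> E v z) \<and> \<not> (E x v \<and> E y v \<and> E z v)"
      proof (cases "v \<in> V")
        case True
        then have "arc v x * arc v y * arc v z + arc x v * arc y v * arc z v = 0"
          using c L[rule_format, of v x y z] E_in[of x y] E_in[of y z] by simp
        then have "arc v x * arc v y * arc v z = 0 \<and> arc x v * arc y v * arc z v = 0"
          by (simp only: add_nonneg_eq_0_iff mult_nonneg_nonneg zero_less_eq_of_bool)
        then show ?thesis by auto
      next
        case False
        then show ?thesis using E_in[of v x] E_in[of x v] by blast
      qed
    qed
  next
    assume R: ?R
    show ?L
    proof (intro ballI)
      fix v x y z
      show "arc x y * arc y z * arc z x * (arc v x * arc v y * arc v z + arc x v * arc y v * arc z v) = 0"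
        using R[rule_format, of x y z v] by (cases "E x y \<and> E y z \<and> E z x") auto
    qed
  qed
  finally show ?thesis .
qed

text \<open>Induction on \<open>S\<close>: a new vertex \<open>a\<close> that is not dominated by
  the old source \<open>s\<close> is itself a source, since \<open>x -> a\<close> would close the
  cyclic triangle \<open>a -> s -> x -> a\<close>.\<close>

lemma finite_acyclic_source:
  assumes "finite S" "S \<noteq> {}" "S \<subseteq> V"
    and "\<And>x y z. x \<in> S \<Longrightarrow> y \<in> S \<Longrightarrow> z \<in> S \<Longrightarrow> E x y \<Longrightarrow> E y z \<Longrightarrow> \<not> E z x"
  shows "\<exists>s\<in>S. \<forall>x\<in>S. x \<noteq> s \<longrightarrow> E s x"
  using assms
proof (induction S rule: finite_ne_induct)
  case (insert a S)
  then obtain s where s: "s \<in> S" "\<forall>x\<in>S. x \<noteq> s \<longrightarrow> E s x" by blast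
  show ?case
  proof (cases "E s a")
    case False
    then have as: "E a s" using E_total insert.hyps insert.prems s by (metis insert_subset subsetD)
    have "E a x" if x: "x \<in> S" for x
    proof (rule ccontr)
      assume "\<not> E a x"
      then have "E x a" "x \<noteq> s"
        using x as E_total[of a x] insert.hyps insert.prems by blast+
      then show False using as s x insert.prems(2)[of a s x] by blast
    qed
    then show ?thesis by blast
  qed (use s in auto)
qed auto

end

section \<open>Locally transitive regular tournaments\<close>

text \<open>A tournament without cyclic triangles is transitive, so the first two assumptions make
  all out- and in-neighbourhoods transitive. The third makes out-neighbourhoods nonempty, so that
  each has a source.\<close>

locale locally_transitive_tournament_rel = regular_tournament_rel +
  assumes out_acyclic: "E v x \<Longrightarrow> E v y \<Longrightarrow> E v z \<Longrightarrow> E x y \<Longrightarrow> E y z \<Longrightarrow> \<not> E z x"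
    and in_acyclic: "E x v \<Longrightarrow> E y v \<Longrightarrow> E z v \<Longrightarrow> E x y \<Longrightarrow> E y z \<Longrightarrow> \<not> E z x"
    and m_pos: "0 < m"
begin

definition next_vertex :: "'a \<Rightarrow> 'a" where
  "next_vertex v = (SOME s. E v s \<and> (\<forall>x. E v x \<longrightarrow> x \<noteq> s \<longrightarrow> E s x))"

lemma next_vertex:
  assumes v: "v \<in> V"
  shows "E v (next_vertex v)" "E v x \<Longrightarrow> x \<noteq> next_vertex v \<Longrightarrow> E (next_vertex v) x"
proof -
  have "{y. E v y} \<noteq> {}" using out_card[OF v] m_pos by force
  then have "\<exists>s\<in>{y. E v y}. \<forall>x\<in>{y. E v y}. x \<noteq> s \<longrightarrow> E s x"
    by (rule finite_acyclic_source[OF finite_out _ out_subset]) (use out_acyclic in blast)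
  then have "\<exists>s. E v s \<and> (\<forall>x. E v x \<longrightarrow> x \<noteq> s \<longrightarrow> E s x)" by blast
  from someI_ex[OF this] show "E v (next_vertex v)" "E v x \<Longrightarrow> x \<noteq> next_vertex v \<Longrightarrow> E (next_vertex v) x"
    unfolding next_vertex_def by blast+
qed

lemma next_vertex_in: "v \<in> V \<Longrightarrow> next_vertex v \<in> V"
  using next_vertex(1) E_in by blast

text \<open>The source of the out-neighbourhood of \<open>v\<close> dominates the other
  \<open>m - 1\<close> out-neighbours of \<open>v\<close>, so by regularity it has exactly one
  further out-neighbour \<open>w\<close>.\<close>

lemma out_next_vertex:
  assumes v: "v \<in> V"
  obtains w where "{y. E (next_vertex v) y} = insert w ({y. E v y} - {next_vertex v})"
    "\<not> E v w" "\<And>x. E v x \<Longrightarrow> x \<noteq> next_vertex v \<Longrightarrow> E x w"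
proof -
  let ?s = "next_vertex v"
  let ?N = "{y. E v y} - {?s}"
  have sV: "?s \<in> V" using v by (rule next_vertex_in)
  have N: "?N \<subseteq> {y. E ?s y}" using next_vertex(2)[OF v] by auto
  have "card ?N = m - 1" using next_vertex(1)[OF v] out_card[OF v] finite_out by simp
  then have "card ({y. E ?s y} - ?N) = 1"
    using card_Diff_subset[OF _ N] finite_out out_card[OF sV] m_pos by simp
  then obtain w where w: "{y. E ?s y} - ?N = {w}" by (auto simp: card_1_singleton_iff)
  then have sw: "E ?s w" and wN: "w \<notin> ?N" by auto
  have eq: "{y. E ?s y} = insert w ?N" using w N by auto
  have vw: "\<not> E v w" using sw wN E_irrefl by auto
  have "w \<noteq> v" using sw next_vertex(1)[OF v] E_asym by blast
  then have wv: "E w v" using vw v sw E_in E_total by blast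
  \<comment> \<open>If \<open>w -> x\<close>, the cyclic triangle \<open>v -> ?s -> w -> v\<close>
    lies in the in-neighbourhood of \<open>x\<close>.\<close>
  have "E x w" if x: "E v x" "x \<noteq> ?s" for x
  proof (rule ccontr)
    assume "\<not> E x w"
    moreover have "x \<noteq> w" using x vw by blast
    ultimately have "E w x" using x sw E_in E_total by blast
    then show False
      using in_acyclic[of v x ?s w] x next_vertex[OF v] sw wv by blast
  qed
  then show thesis using that eq vw by blast
qed

lemma funpow_next_vertex_in: "v \<in> V \<Longrightarrow> (next_vertex ^^ i) v \<in> V"
  by (induction i) (auto simp: next_vertex_in)

text \<open>Induction on \<open>d\<close>, with the hypothesis applied to
  \<open>next_vertex v\<close>: its iterates are those of \<open>v\<close> shifted by one, and its
  out-neighbourhood differs from that of \<open>v\<close> only by losing the source and gaining a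
  sink.\<close>

lemma funpow_next_vertex_source:
  assumes "v \<in> V" "d < m"
  defines "R \<equiv> {y. E v y} - (\<lambda>i. (next_vertex ^^ i) v) ` {1..d}"
  shows "(next_vertex ^^ Suc d) v \<in> R \<and> (\<forall>x\<in>R. x \<noteq> (next_vertex ^^ Suc d) v \<longrightarrow> E ((next_vertex ^^ Suc d) v) x)"
  using assms(1,2) unfolding R_def
proof (induction d arbitrary: v)
  case 0
  then show ?case using next_vertex[of v] by auto
next
  case (Suc d)
  let ?n = "next_vertex"
  let ?s = "?n v"
  let ?t = "(?n ^^ Suc (Suc d)) v"
  let ?R = "{y. E v y} - (\<lambda>i. (?n ^^ i) v) ` {1..Suc d}"
  let ?R' = "{y. E ?s y} - (\<lambda>i. (?n ^^ i) ?s) ` {1..d}"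
  have sh: "(?n ^^ i) ?s = (?n ^^ Suc i) v" for i by (simp add: funpow_swap1)
  have IH: "?t \<in> ?R'" "\<forall>x\<in>?R'. x \<noteq> ?t \<longrightarrow> E ?t x"
    using Suc.IH[of ?s] Suc.prems next_vertex_in unfolding sh by auto
  obtain w where w: "{y. E ?s y} = insert w ({y. E v y} - {?s})" "\<not> E v w"
    "\<And>x. E v x \<Longrightarrow> x \<noteq> ?s \<Longrightarrow> E x w"
    using out_next_vertex[OF Suc.prems(1)] by blast
  have split: "(\<lambda>i. (?n ^^ i) v) ` {1..Suc d} = insert ?s ((\<lambda>i. (?n ^^ i) ?s) ` {1..d})"
  proof -
    have "{1..Suc d} = insert 1 (Suc ` {1..d})" by (auto simp: image_Suc_atLeastAtMost)
    then have "(\<lambda>i. (?n ^^ i) v) ` {1..Suc d} = insert ((?n ^^ 1) v) ((\<lambda>i. (?n ^^ Suc i) v) ` {1..d})"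
      by (simp only: image_insert image_image)
    then show ?thesis unfolding sh by simp
  qed
  have sub: "?R \<subseteq> ?R'" "?R' \<subseteq> insert w ?R" unfolding split w(1) by auto
  \<comment> \<open>As \<open>Suc d < m\<close>, some \<open>x\<close> remains in \<open>?R\<close>.
    It rules out that \<open>?t\<close> is the new sink \<open>w\<close>: the source
    \<open>?t\<close> dominates \<open>x\<close>, whereas \<open>x -> w\<close>.\<close>
  have "card ?R \<ge> card {y. E v y} - card ((\<lambda>i. (?n ^^ i) v) ` {1..Suc d})"
    by (rule diff_card_le_card_Diff) simp
  moreover have "card ((\<lambda>i. (?n ^^ i) v) ` {1..Suc d}) \<le> Suc d"
    using card_image_le[of "{1..Suc d}" "\<lambda>i. (?n ^^ i) v"] by simp
  ultimately have "card ?R > 0" using out_card[OF Suc.prems(1)] Suc.prems(2) by linarith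
  then obtain x where x: "x \<in> ?R" by (auto simp: card_gt_0_iff)
  have "?t \<noteq> w"
  proof
    assume t: "?t = w"
    have "E v x" "x \<noteq> ?s" using x unfolding split by auto
    then have "E x w" "x \<noteq> w" using w(2,3) by auto
    moreover have "E w x" using IH(2) x sub(1) \<open>x \<noteq> w\<close> unfolding t by blast
    ultimately show False using E_asym by blast
  qed
  then show ?case using IH sub by blast
qed

lemma E_funpow_next_vertex:
  assumes "v \<in> V" "1 \<le> d" "d \<le> m"
  shows "E v ((next_vertex ^^ d) v)"
  using funpow_next_vertex_source[of v "d - 1"] assms by auto

text \<open>The arcs from \<open>u i\<close> to the next \<open>m\<close> iterates give injectivity
  on \<open>2 * m + 1\<close> indices, hence surjectivity by counting. They also exhaust the
  out-degree, which forces the direction of the remaining arcs.\<close>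

lemma rotational_enumeration:
  assumes v: "v \<in> V"
  defines "u \<equiv> (\<lambda>i. (next_vertex ^^ i) v)"
  shows "bij_betw u {0..<2 * m + 1} V"
    and "i < 2 * m + 1 \<Longrightarrow> j < 2 * m + 1 \<Longrightarrow>
      E (u i) (u j) \<longleftrightarrow> i < j \<and> j \<le> i + m \<or> j + m < i"
proof -
  have uV: "u i \<in> V" for i unfolding u_def using v by (rule funpow_next_vertex_in)
  have step: "E (u i) (u j)" if "i < j" "j \<le> i + m" for i j
  proof -
    have "u j = (next_vertex ^^ (j - i)) (u i)"
      unfolding u_def using that by (simp flip: funpow_add[THEN fun_cong, unfolded o_apply])
    then show ?thesis using E_funpow_next_vertex[OF uV, of "j - i" i] that by simp
  qed
  have neq: "u i \<noteq> u j" if "i < j" "j < 2 * m + 1" for i j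
  proof (cases "j \<le> i + m")
    case True
    then show ?thesis using step that E_irrefl by metis
  next
    case False
    \<comment> \<open>Since \<open>j \<le> 2 * m\<close>, the vertex \<open>u (i + m)\<close> is
      within \<open>m\<close> steps of both ends, and \<open>u i = u j\<close> would make these two
      arcs opposite.\<close>
    then have "E (u i) (u (i + m))" "E (u (i + m)) (u j)" using that m_pos by (auto intro: step)
    then show ?thesis using E_asym by metis
  qed
  have inj: "inj_on u {0..<2 * m + 1}"
    by (rule inj_onI) (metis neq atLeastLessThan_iff linorder_neqE_nat)
  then have "u ` {0..<2 * m + 1} = V"
    using uV finite_V card_V by (intro card_subset_eq) (auto simp: card_image)
  then show "bij_betw u {0..<2 * m + 1} V" using inj by (simp add: bij_betw_def)
  \<comment> \<open>The \<open>m\<close> out-neighbours of \<open>u i\<close> are already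
    \<open>u (i + 1)\<close> up to \<open>u (i + m)\<close>.\<close>
  have far: "E (u j) (u i)" if "i + m < j" "j < 2 * m + 1" for i j
  proof -
    have inj': "inj_on u {i + 1..i + m}"
      by (rule inj_on_subset[OF inj]) (use that in auto)
    have "u ` {i + 1..i + m} = {y. E (u i) y}"
      using step out_card[OF uV] inj' finite_out
      by (intro card_subset_eq) (auto simp: card_image)
    moreover have "u j \<notin> u ` {i + 1..i + m}" using neq[of _ j] that by (metis imageE atLeastAtMost_iff le_less_trans)
    ultimately have "\<not> E (u i) (u j)" by blast
    then show ?thesis using E_total[OF uV uV, of i j] neq[of i j] that by auto
  qed
  show "E (u i) (u j) \<longleftrightarrow> i < j \<and> j \<le> i + m \<or> j + m < i" if "i < 2 * m + 1" "j < 2 * m + 1"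
  proof
    assume e: "E (u i) (u j)"
    show "i < j \<and> j \<le> i + m \<or> j + m < i"
    proof (rule ccontr)
      assume "\<not> ?thesis"
      then have "i = j \<or> i + m < j \<or> j < i \<and> i \<le> j + m" by linarith
      then have "i = j \<or> E (u j) (u i)" using step far that by blast
      then show False using e E_irrefl E_asym by blast
    qed
  qed (use step far that in blast)
qed

end

section \<open>Entropy of regular tournaments\<close>

lemma regular_tournament_relI:
  assumes r: "regular_tournament (2 * m + 1) T"
  shows "regular_tournament_rel (pverts T) (\<lambda>x y. (x, y) \<in> parcs T) m"
    and "v \<in> pverts T \<Longrightarrow> out_degree T v = m"
proof -
  have t: "tournament (2 * m + 1) T" using r by (simp add: regular_tournament_def)
  have deg: "out_degree T v = m" if "v \<in> pverts T" for v
  proof -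
    have "real (out_degree T v) = (real (2 * m + 1) - 1) / 2"
      using r that unfolding regular_tournament_def by blast
    then show ?thesis by simp
  qed
  show "v \<in> pverts T \<Longrightarrow> out_degree T v = m" by (rule deg)
  interpret pair_digraph T using t by (simp add: tournament_def)
  show "regular_tournament_rel (pverts T) (\<lambda>x y. (x, y) \<in> parcs T) m"
  proof
    fix x assume x: "x \<in> pverts T"
    have "out_arcs T x = Pair x ` {y. (x, y) \<in> parcs T}" by (auto simp: out_arcs_def)
    then have "card (out_arcs T x) = card {y. (x, y) \<in> parcs T}" by (simp add: card_image inj_on_def)
    then show "card {y. (x, y) \<in> parcs T} = m" using deg[OF x] by (simp add: out_degree_def)
  next
    show "finite (pverts T)" by (rule pair_finite_verts)
    show "card (pverts T) = 2 * m + 1" using t by (simp add: tournament_def)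
    show "\<And>x y. (x, y) \<in> parcs T \<Longrightarrow> x \<in> pverts T \<and> y \<in> pverts T"
      by (blast intro: in_arcsD1 in_arcsD2)
    show "(x, x) \<notin> parcs T" for x using pair_no_loops[of "(x, x)"] by auto
    show "\<And>x y. x \<in> pverts T \<Longrightarrow> y \<in> pverts T \<Longrightarrow> x \<noteq> y \<Longrightarrow> ((x, y) \<in> parcs T) \<noteq> ((y, x) \<in> parcs T)"
      using t unfolding tournament_def by blast
  qed
qed

text \<open>An entry of a matrix power sums the weights of walks between two vertices; the diagonal
  collects the closed ones.\<close>

lemma trace_pow_eq_closed_walks:
  fixes f :: "'a \<Rightarrow> 'a \<Rightarrow> 'b::comm_semiring_1"
  assumes vs: "distinct vs" "set vs = V" and n: "n = length vs"
  defines "A \<equiv> mat n n (\<lambda>(i, j). f (vs ! i) (vs ! j))"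
  shows "(\<Sum>i<n. (A ^\<^sub>m 1) $$ (i, i)) = (\<Sum>x\<in>V. f x x)"
    and "(\<Sum>i<n. (A ^\<^sub>m 2) $$ (i, i)) = (\<Sum>x\<in>V. \<Sum>y\<in>V. f x y * f y x)"
    and "(\<Sum>i<n. (A ^\<^sub>m 3) $$ (i, i)) = (\<Sum>x\<in>V. \<Sum>y\<in>V. \<Sum>z\<in>V. f x y * f y z * f z x)"
    and "(\<Sum>i<n. (A ^\<^sub>m 4) $$ (i, i)) =
      (\<Sum>x\<in>V. \<Sum>y\<in>V. \<Sum>z\<in>V. \<Sum>w\<in>V. f x y * f y z * f z w * f w x)"
proof -
  have A: "A \<in> carrier_mat n n" by (simp add: A_def)
  have re: "(\<Sum>i<n. g (vs ! i)) = (\<Sum>x\<in>V. g x)" for g :: "'a \<Rightarrow> 'b"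
    by (rule sum.reindex_bij_betw) (rule bij_betw_nth[OF vs(1)], auto simp: n vs(2))
  have E1: "A ^\<^sub>m 1 = A" using A by simp
  have P1: "(A ^\<^sub>m 1) $$ (i, j) = f (vs ! i) (vs ! j)" if "i < n" "j < n" for i j
    using that unfolding E1 by (simp add: A_def)
  have step: "(A ^\<^sub>m Suc k) $$ (i, j) = (\<Sum>x\<in>V. g (vs ! i) x * f x (vs ! j))"
    if "\<And>i j. i < n \<Longrightarrow> j < n \<Longrightarrow> (A ^\<^sub>m k) $$ (i, j) = g (vs ! i) (vs ! j)" "i < n" "j < n" for k g i j
  proof -
    have "(A ^\<^sub>m Suc k) $$ (i, j) = (\<Sum>l<n. (A ^\<^sub>m k) $$ (i, l) * A $$ (l, j))"
      using that A pow_carrier_mat[OF A, of k] by (simp add: scalar_prod_def atLeast0LessThan)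
    also have "\<dots> = (\<Sum>l<n. g (vs ! i) (vs ! l) * f (vs ! l) (vs ! j))"
      using that by (intro sum.cong) (auto simp: A_def)
    finally show ?thesis using re[of "\<lambda>x. g (vs ! i) x * f x (vs ! j)"] by simp
  qed
  have P2: "(A ^\<^sub>m 2) $$ (i, j) = (\<Sum>y\<in>V. f (vs ! i) y * f y (vs ! j))" if "i < n" "j < n" for i j
    using step[OF P1, of i j] that by (simp add: numeral_2_eq_2)
  have P3: "(A ^\<^sub>m 3) $$ (i, j) = (\<Sum>z\<in>V. (\<Sum>y\<in>V. f (vs ! i) y * f y z) * f z (vs ! j))"
    if "i < n" "j < n" for i j
    using step[OF P2, of i j] that by (simp add: eval_nat_numeral)
  have P4: "(A ^\<^sub>m 4) $$ (i, j) =
      (\<Sum>w\<in>V. (\<Sum>z\<in>V. (\<Sum>y\<in>V. f (vs ! i) y * f y z) * f z w) * f w (vs ! j))"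
    if "i < n" "j < n" for i j
    using step[OF P3, of i j] that by (simp add: eval_nat_numeral)
  show "(\<Sum>i<n. (A ^\<^sub>m 1) $$ (i, i)) = (\<Sum>x\<in>V. f x x)"
    by (subst re[symmetric]) (rule sum.cong; simp only: P1 lessThan_iff)
  show "(\<Sum>i<n. (A ^\<^sub>m 2) $$ (i, i)) = (\<Sum>x\<in>V. \<Sum>y\<in>V. f x y * f y x)"
    by (subst re[of "\<lambda>x. \<Sum>y\<in>V. f x y * f y x", symmetric]) (rule sum.cong; simp add: P2)
  show "(\<Sum>i<n. (A ^\<^sub>m 3) $$ (i, i)) = (\<Sum>x\<in>V. \<Sum>y\<in>V. \<Sum>z\<in>V. f x y * f y z * f z x)"
  proof -
    have "(\<Sum>i<n. (A ^\<^sub>m 3) $$ (i, i)) = (\<Sum>x\<in>V. \<Sum>z\<in>V. (\<Sum>y\<in>V. f x y * f y z) * f z x)"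
      by (subst re[symmetric]) (rule sum.cong; simp add: P3)
    then show ?thesis
      unfolding sum_distrib_right by (simp only:) (intro sum.cong refl sum.swap)
  qed
  show "(\<Sum>i<n. (A ^\<^sub>m 4) $$ (i, i)) =
      (\<Sum>x\<in>V. \<Sum>y\<in>V. \<Sum>z\<in>V. \<Sum>w\<in>V. f x y * f y z * f z w * f w x)"
  proof -
    let ?g = "\<lambda>x y z w. f x y * f y z * f z w * f w x"
    have "(\<Sum>i<n. (A ^\<^sub>m 4) $$ (i, i)) = (\<Sum>x\<in>V. \<Sum>w\<in>V. (\<Sum>z\<in>V. (\<Sum>y\<in>V. f x y * f y z) * f z w) * f w x)"
      by (subst re[symmetric]) (rule sum.cong; simp add: P4)
    also have "\<dots> = (\<Sum>x\<in>V. \<Sum>w\<in>V. \<Sum>z\<in>V. \<Sum>y\<in>V. ?g x y z w)"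
      unfolding sum_distrib_right ..
    also have "\<dots> = (\<Sum>x\<in>V. \<Sum>w\<in>V. \<Sum>y\<in>V. \<Sum>z\<in>V. ?g x y z w)"
      by (intro sum.cong refl sum.swap)
    also have "\<dots> = (\<Sum>x\<in>V. \<Sum>y\<in>V. \<Sum>w\<in>V. \<Sum>z\<in>V. ?g x y z w)"
      by (intro sum.cong refl sum.swap)
    also have "\<dots> = (\<Sum>x\<in>V. \<Sum>y\<in>V. \<Sum>z\<in>V. \<Sum>w\<in>V. ?g x y z w)"
      by (intro sum.cong refl sum.swap)
    finally show ?thesis .
  qed
qed

text \<open>With \<open>D\<close> scalar, the Laplacian eigenvalues are scaled values
  \<open>m - e\<close> for adjacency eigenvalues \<open>e\<close>. Expanding the fourth power leaves
  the power sums of \<open>e\<close>, which are traces; only the fourth depends on more than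
  \<open>m\<close>.\<close>

lemma renyi_entropy_4_regular:
  assumes r: "regular_tournament (2 * m + 1) T"
  defines "E \<equiv> \<lambda>x y. (x, y) \<in> parcs T"
  shows "renyi_entropy_4 T = - (1 / 3) * log 2
    (((2 * real m + 1) * m ^ 4 - 2 * (real m)\<^sup>2 * (2 * real m + 1) * (m + 1)
      + regular_tournament_rel.closed_walks4 (pverts T) E)
     / real ((2 * m + 1) choose 2) ^ 4)"
proof -
  interpret regular_tournament_rel "pverts T" E m
    unfolding E_def using r by (rule regular_tournament_relI)
  define n where "n = 2 * m + 1"
  define c where "c = inverse (complex_of_nat (n choose 2))"
  obtain vs where vs: "distinct vs" "set vs = pverts T"
    using finite_V finite_distinct_list by blast
  have len: "n = length vs" using vs card_V distinct_card[of vs] by (simp add: n_def)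
  define f :: "'a \<Rightarrow> 'a \<Rightarrow> complex" where "f = (\<lambda>x y. of_bool (E x y))"
  have of_real_arc: "of_real (arc x y) = f x y" for x y by (simp add: f_def of_bool_def)
  define A where "A = mat n n (\<lambda>(i, j). f (vs ! i) (vs ! j))"
  have deg: "out_degree T (vs ! j) = m" if "j < length vs" for j
    using regular_tournament_relI(2)[OF r] vs nth_mem[OF that] by simp
  have "normalized_laplacian vs T = c \<cdot>\<^sub>m (of_nat m \<cdot>\<^sub>m 1\<^sub>m n - A)"
    using vs unfolding normalized_laplacian_def out_degree_matrix_def adjacency_matrix_def card_V n_def[symmetric] c_def[symmetric]
    by (intro eq_matI) (auto simp: A_def f_def E_def len deg)
  moreover obtain es where es: "length es = n"
    "\<And>k. (\<Sum>e\<leftarrow>es. e ^ k) = (\<Sum>i<n. (A ^\<^sub>m k) $$ (i, i))"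
    "\<And>c d. proots (char_poly (c \<cdot>\<^sub>m (d \<cdot>\<^sub>m 1\<^sub>m n - A))) = mset (map (\<lambda>e. c * (d - e)) es)"
    using spectrum_shifted_scaled[of A n] by (auto simp: A_def)
  ultimately have spec: "laplacian_spectrum T = mset (map (\<lambda>e. c * (of_nat m - e)) es)"
    using vs by (simp add: laplacian_spectrum_eq[of vs] enumerates_def)
  \<comment> \<open>The exponents \<open>0\<close> and \<open>1\<close> are kept so that every term
    is a power sum.\<close>
  have binomial4: "(a - e) ^ 4 = a ^ 4 * e ^ 0 + (- 4 * a ^ 3) * e ^ 1 + 6 * a ^ 2 * e ^ 2
      + (- 4 * a) * e ^ 3 + e ^ 4" for a e :: complex
    by (simp add: eval_nat_numeral algebra_simps)
  have "(\<Sum>z\<in>#laplacian_spectrum T. z ^ 4) = (\<Sum>e\<leftarrow>es. (c * (of_nat m - e)) ^ 4)"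
    unfolding spec by (simp add: o_def flip: mset_map sum_mset_sum_list)
  also have "\<dots> = (\<Sum>e\<leftarrow>es. c ^ 4 * (of_nat m ^ 4 * e ^ 0 + (- 4 * of_nat m ^ 3) * e ^ 1
      + 6 * of_nat m ^ 2 * e ^ 2 + (- 4 * of_nat m) * e ^ 3 + e ^ 4))"
    by (simp only: power_mult_distrib binomial4)
  also have "\<dots> = c ^ 4 * (of_nat m ^ 4 * (\<Sum>e\<leftarrow>es. e ^ 0) + (- 4 * of_nat m ^ 3) * (\<Sum>e\<leftarrow>es. e ^ 1)
      + 6 * of_nat m ^ 2 * (\<Sum>e\<leftarrow>es. e ^ 2) + (- 4 * of_nat m) * (\<Sum>e\<leftarrow>es. e ^ 3) + (\<Sum>e\<leftarrow>es. e ^ 4))"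
    by (simp only: sum_list_const_mult sum_list_addf)
  also have "(\<Sum>e\<leftarrow>es. e ^ 0) = of_nat n" by (simp add: sum_list_triv es(1))
  \<comment> \<open>The first two traces vanish because there are no loops and no 2-cycles.\<close>
  also have "(\<Sum>e\<leftarrow>es. e ^ 1) = 0"
    unfolding es(2) A_def trace_pow_eq_closed_walks[OF vs len] by (simp add: f_def E_irrefl)
  also have "(\<Sum>e\<leftarrow>es. e ^ 2) = 0"
    unfolding es(2) A_def trace_pow_eq_closed_walks[OF vs len]
    by (intro sum.neutral ballI) (auto simp: f_def dest: E_asym)
  also have "(\<Sum>e\<leftarrow>es. e ^ 3) = of_real closed_walks3"
    unfolding es(2) A_def trace_pow_eq_closed_walks[OF vs len] closed_walks3_def
    by (simp only: of_real_sum of_real_mult of_real_arc)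
  also have "(\<Sum>e\<leftarrow>es. e ^ 4) = of_real closed_walks4"
    unfolding es(2) A_def trace_pow_eq_closed_walks[OF vs len] closed_walks4_def
    by (simp only: of_real_sum of_real_mult of_real_arc)
  also have "c ^ 4 * (of_nat m ^ 4 * of_nat n + - 4 * of_nat m ^ 3 * 0 + 6 * of_nat m ^ 2 * 0
      + - 4 * of_nat m * of_real closed_walks3 + of_real closed_walks4)
    = of_real (((real m) ^ 4 * n - 4 * m * closed_walks3 + closed_walks4) / (real (n choose 2)) ^ 4)"
    by (simp add: c_def field_simps)
  also have "(real m) ^ 4 * n - 4 * m * closed_walks3 + closed_walks4 =
    (2 * real m + 1) * m ^ 4 - 2 * (real m)\<^sup>2 * (2 * real m + 1) * (m + 1) + closed_walks4"
    unfolding closed_walks3_eq n_def by (simp add: power2_eq_square algebra_simps)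
  finally show ?thesis unfolding renyi_entropy_4_def n_def by simp
qed

section \<open>Isomorphisms and the consecutive rotational tournament\<close>

lemma digraph_iso_pairI:
  fixes T :: "'a pair_pre_digraph" and T' :: "'b pair_pre_digraph"
  assumes wf: "pair_wf_digraph T" and inj: "inj_on f (pverts T)" and V: "pverts T' = f ` pverts T"
    and E: "parcs T' = (\<lambda>(x, y). (f x, f y)) ` parcs T"
  shows "digraph_iso T T'"
proof -
  interpret pair_wf_digraph T by (rule wf)
  let ?h = "\<lparr>iso_verts = f, iso_arcs = \<lambda>(x, y). (f x, f y), iso_head = snd, iso_tail = fst\<rparr>"
  have "wf_digraph (with_proj T)" by (simp add: wf_digraph_wp_iff wf)
  moreover have "inj_on (\<lambda>(x, y). (f x, f y)) (parcs T)"
    using inj_onD[OF inj] in_arcsD1 in_arcsD2 by (auto simp: inj_on_def)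
  ultimately have "pre_digraph.digraph_isomorphism (with_proj T) ?h"
    using inj by (auto simp: pre_digraph.digraph_isomorphism_def)
  moreover have "with_proj T' = app_iso ?h (with_proj T)"
    by (simp add: app_iso_def with_proj_def V E)
  ultimately show ?thesis unfolding digraph_iso_def by blast
qed

text \<open>Replaces the congruence by inequalities between representatives, in the same form as in
  \<open>rotational_enumeration\<close>.\<close>

lemma consecutive_rotational_arc_iff:
  "(i, j) \<in> parcs (consecutive_rotational m) \<longleftrightarrow>
    i < 2 * m + 1 \<and> j < 2 * m + 1 \<and> (i < j \<and> j \<le> i + m \<or> j + m < i)"
proof -
  have "(\<exists>d\<in>{1..m}. [int j - int i = int d] (mod int (2 * m + 1))) \<longleftrightarrow> i < j \<and> j \<le> i + m \<or> j + m < i"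
    if ij: "i < 2 * m + 1" "j < 2 * m + 1"
  proof
    assume "\<exists>d\<in>{1..m}. [int j - int i = int d] (mod int (2 * m + 1))"
    then obtain d where d: "1 \<le> d" "d \<le> m" "int (2 * m + 1) dvd (int j - int i - int d)"
      by (auto simp: cong_iff_dvd_diff)
    then obtain k where k: "int j - int i - int d = int (2 * m + 1) * k" by blast
    \<comment> \<open>The difference \<open>j - i - d\<close> lies strictly between
      \<open>-2\<close> and \<open>1\<close> times the modulus. Here \<open>k = 0\<close> is an arc
      without wrap-around and \<open>k = -1\<close> one with it.\<close>
    have "k < 1" "k > - 2"
    proof -
      have "int (2 * m + 1) * k < int (2 * m + 1) * 1" unfolding k[symmetric] using ij d by simp
      then show "k < 1" by (rule mult_left_less_imp_less) simp
      have "int (2 * m + 1) * (- 2) < int (2 * m + 1) * k" unfolding k[symmetric] using ij d by simp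
      then show "k > - 2" by (rule mult_left_less_imp_less) simp
    qed
    then have "k = 0 \<or> k = - 1" by auto
    then show "i < j \<and> j \<le> i + m \<or> j + m < i" using k d ij by auto
  next
    assume "i < j \<and> j \<le> i + m \<or> j + m < i"
    then show "\<exists>d\<in>{1..m}. [int j - int i = int d] (mod int (2 * m + 1))"
    proof
      assume "i < j \<and> j \<le> i + m"
      then show ?thesis by (intro bexI[of _ "j - i"]) (auto simp: of_nat_diff)
    next
      assume "j + m < i"
      then have "int j - int i - int (2 * m + 1 - i + j) = - int (2 * m + 1)"
        using ij by (simp add: of_nat_diff)
      then have "[int j - int i = int (2 * m + 1 - i + j)] (mod int (2 * m + 1))"
        unfolding cong_iff_dvd_diff by (simp only: dvd_minus_iff dvd_refl)
      then show ?thesis using ij \<open>j + m < i\<close>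
        by (intro bexI[of _ "2 * m + 1 - i + j"]) auto
    qed
  qed
  then show ?thesis by (auto simp: consecutive_rotational_def)
qed

lemma pverts_consecutive_rotational: "pverts (consecutive_rotational m) = {0..<2 * m + 1}"
  by (simp add: consecutive_rotational_def)

lemma regular_consecutive_rotational:
  "regular_tournament (2 * m + 1) (consecutive_rotational m)"
proof -
  let ?T = "consecutive_rotational m"
  have sub: "parcs ?T \<subseteq> {0..<2 * m + 1} \<times> {0..<2 * m + 1}"
    by (auto simp: consecutive_rotational_arc_iff)
  have "pair_digraph ?T"
  proof
    show "finite (parcs ?T)" using sub by (rule finite_subset) simp
  qed (auto simp: pverts_consecutive_rotational consecutive_rotational_arc_iff)
  moreover have "out_degree ?T v = m" if v: "v \<in> pverts ?T" for v
  proof -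
    \<comment> \<open>The second interval is the part that wraps around; by truncated subtraction it
      is empty for \<open>v \<le> m\<close>.\<close>
    have "out_arcs ?T v = Pair v ` ({v + 1..min (2 * m) (v + m)} \<union> {0..<v - m})"
      using v by (auto simp: out_arcs_def consecutive_rotational_arc_iff pverts_consecutive_rotational)
    then have "out_degree ?T v = card ({v + 1..min (2 * m) (v + m)} \<union> {0..<v - m})"
      by (simp add: out_degree_def card_image inj_on_def)
    also have "\<dots> = card {v + 1..min (2 * m) (v + m)} + card {0..<v - m}"
      by (rule card_Un_disjoint) auto
    also have "\<dots> = m" using v by (auto simp: pverts_consecutive_rotational)
    finally show ?thesis .
  qed
  ultimately show ?thesis
    by (auto simp: regular_tournament_def tournament_def pverts_consecutive_rotational
        consecutive_rotational_arc_iff)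
qed

text \<open>Out- and in-neighbourhoods are cyclic intervals of \<open>m\<close> vertices, inside
  which arcs only point forward. Formally, each choice of which arcs wrap around gives an infeasible
  system of linear inequalities.\<close>

lemma dominated_consecutive_rotational:
  "regular_tournament_rel.dominated (pverts (consecutive_rotational m))
    (\<lambda>x y. (x, y) \<in> parcs (consecutive_rotational m)) = 0"
proof -
  interpret regular_tournament_rel "pverts (consecutive_rotational m)"
    "\<lambda>x y. (x, y) \<in> parcs (consecutive_rotational m)" m
    using regular_consecutive_rotational by (rule regular_tournament_relI)
  define P where "P i j \<longleftrightarrow> i < j \<and> j \<le> i + m \<or> j + m < i" for i j
  have arcD: "P i j" "i < 2 * m + 1" "j < 2 * m + 1" if "(i, j) \<in> parcs (consecutive_rotational m)" for i j
    using that by (simp_all add: P_def consecutive_rotational_arc_iff)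
  have out: False
    if "P x y" "P y z" "P z x" "P v x" "P v y" "P v z"
      "x < 2 * m + 1" "y < 2 * m + 1" "z < 2 * m + 1" "v < 2 * m + 1" for v x y z
    using that unfolding P_def by (elim disjE conjE) linarith+
  have inn: False
    if "P x y" "P y z" "P z x" "P x v" "P y v" "P z v"
      "x < 2 * m + 1" "y < 2 * m + 1" "z < 2 * m + 1" "v < 2 * m + 1" for v x y z
    using that unfolding P_def by (elim disjE conjE) linarith+
  show ?thesis
    unfolding dominated_eq_0_iff
  proof (intro allI impI conjI notI; elim conjE)
    fix v x y z
    let ?A = "parcs (consecutive_rotational m)"
    assume c: "(x, y) \<in> ?A" "(y, z) \<in> ?A" "(z, x) \<in> ?A"
    show False if "(v, x) \<in> ?A" "(v, y) \<in> ?A" "(v, z) \<in> ?A"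
      using out[of x y z v] c that arcD by blast
    show False if "(x, v) \<in> ?A" "(y, v) \<in> ?A" "(z, v) \<in> ?A"
      using inn[of x y z v] c that arcD by blast
  qed
qed

text \<open>Competitors on natural numbers represent all isomorphism classes, since a finite
  tournament can be relabelled by naturals and its spectrum is invariant under isomorphism.\<close>

theorem theorem4:
  fixes m :: nat and T :: "'a pair_pre_digraph"
  assumes "2 * m + 1 > 5"
    and "regular_tournament (2 * m + 1) T"
  shows "(\<forall>T' :: nat pair_pre_digraph. regular_tournament (2 * m + 1) T' \<longrightarrow>
            renyi_entropy_4 T \<le> renyi_entropy_4 T')
         \<longleftrightarrow> digraph_iso T (consecutive_rotational m)"
  (is "?min \<longleftrightarrow> ?iso")
proof
  let ?R = "consecutive_rotational m"
  let ?E = "\<lambda>(G :: nat pair_pre_digraph) x y. (x, y) \<in> parcs G"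
  have m: "m \<ge> 3" using assms(1) by simp
  interpret T: regular_tournament_rel "pverts T" "\<lambda>x y. (x, y) \<in> parcs T" m
    using assms(2) by (rule regular_tournament_relI)
  interpret R: regular_tournament_rel "pverts ?R" "?E ?R" m
    using regular_consecutive_rotational by (rule regular_tournament_relI)
  \<comment> \<open>\<open>K\<close> and \<open>C\<close> depend on \<open>m\<close> alone, so
    \<open>h\<close> expresses the entropy through the number of closed 4-walks.\<close>
  define K where "K = (2 * real m + 1) * m ^ 4 - 2 * (real m)\<^sup>2 * (2 * real m + 1) * (m + 1)"
  define C where "C = real ((2 * m + 1) choose 2) ^ 4"
  define h :: "real \<Rightarrow> real" where "h q = - (1 / 3) * log 2 ((K + q) / C)" for q
  \<comment> \<open>Positivity amounts to \<open>m^2 > 2 (m + 1)\<close>, which holds from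
    \<open>m = 3\<close> on. It keeps the arguments of the logarithm positive and makes
    \<open>h\<close> strictly decreasing on nonnegative numbers.\<close>
  have "0 < K"
  proof -
    have "2 * (r + 1) < r * r" if "3 \<le> r" for r :: real
      using zero_le_square[of "r - 3"] that by (simp add: algebra_simps)
    from this[of "real m"] have "2 * (real m + 1) < real m * real m" using m by simp
    then have "0 < (2 * real m + 1) * (real m)\<^sup>2 * (real m * m - 2 * (real m + 1))"
      using m by simp
    then show ?thesis by (simp add: K_def power2_eq_square power4_eq_xxxx algebra_simps)
  qed
  have h: "h p \<le> h q \<longleftrightarrow> q \<le> p" if "0 \<le> p" "0 \<le> q" for p q
  proof -
    have C: "C > 0" using m by (simp add: C_def)
    then have "h p \<le> h q \<longleftrightarrow> (K + q) / C \<le> (K + p) / C"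
      using \<open>0 < K\<close> that by (simp add: h_def)
    then show ?thesis using C by (simp add: divide_le_cancel)
  qed
  have nonneg: "0 \<le> regular_tournament_rel.closed_walks4 (pverts G) (\<lambda>x y. (x, y) \<in> parcs G)"
    if "regular_tournament (2 * m + 1) G" for G :: "'b pair_pre_digraph"
    unfolding regular_tournament_rel.closed_walks4_def[OF regular_tournament_relI(1)[OF that]]
    by (intro sum_nonneg) auto
  have HT: "renyi_entropy_4 T = h T.closed_walks4"
    unfolding h_def K_def C_def by (rule renyi_entropy_4_regular[OF assms(2)])
  have HR: "renyi_entropy_4 ?R = h R.closed_walks4"
    unfolding h_def K_def C_def by (rule renyi_entropy_4_regular[OF regular_consecutive_rotational])
  \<comment> \<open>The triangle count depends only on \<open>m\<close>, so that of \<open>T\<close>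
    may stand for that of \<open>?R\<close>.\<close>
  have Rmax: "3 * R.closed_walks4 = 2 * (T.closed_walks3 * (2 * real m - 2))"
    using R.closed_walks4_eq dominated_consecutive_rotational
    by (simp add: R.closed_walks3_eq T.closed_walks3_eq)
  show ?iso if ?min
  proof -
    have "h T.closed_walks4 \<le> h R.closed_walks4"
      using that regular_consecutive_rotational HT HR by metis
    then have "R.closed_walks4 \<le> T.closed_walks4"
      using h nonneg[OF assms(2)] nonneg[OF regular_consecutive_rotational] by blast
    moreover have "3 * T.closed_walks4 = 3 * R.closed_walks4 - 2 * T.dominated"
      unfolding Rmax T.closed_walks4_eq by (simp only: right_diff_distrib)
    ultimately have dom0: "T.dominated = 0" using T.dominated_nonneg by linarith
    interpret T: locally_transitive_tournament_rel "pverts T" "\<lambda>x y. (x, y) \<in> parcs T" m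
    proof
      fix v x y z assume xyz: "(x, y) \<in> parcs T" "(y, z) \<in> parcs T"
      note acyclic = T.dominated_eq_0_iff[THEN iffD1, OF dom0, rule_format, of x y z v]
      show "(z, x) \<notin> parcs T" if "(v, x) \<in> parcs T" "(v, y) \<in> parcs T" "(v, z) \<in> parcs T"
        using acyclic xyz that by blast
      show "(z, x) \<notin> parcs T" if "(x, v) \<in> parcs T" "(y, v) \<in> parcs T" "(z, v) \<in> parcs T"
        using acyclic xyz that by blast
    qed (use m in simp)
    obtain v where v: "v \<in> pverts T" using T.card_V by (cases "pverts T = {}") auto
    define u where "u i = (T.next_vertex ^^ i) v" for i
    note enum = T.rotational_enumeration[OF v, folded u_def]
    \<comment> \<open>The enumeration \<open>u\<close> maps indices to vertices of \<open>T\<close>,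
      so the isomorphism is built in this direction and reversed afterwards.\<close>
    have "digraph_iso ?R T"
    proof (rule digraph_iso_pairI)
      show "inj_on u (pverts ?R)" and img: "pverts T = u ` pverts ?R"
        using enum(1) by (auto simp: bij_betw_def pverts_consecutive_rotational)
      show "pair_wf_digraph ?R"
        by (auto simp: pair_wf_digraph_def consecutive_rotational_arc_iff pverts_consecutive_rotational)
      show "parcs T = (\<lambda>(x, y). (u x, u y)) ` parcs ?R"
      proof (intro equalityI subrelI)
        fix x y assume e: "(x, y) \<in> parcs T"
        then obtain i j where "x = u i" "y = u j" "i < 2 * m + 1" "j < 2 * m + 1"
          using T.E_in[of x y] img by (auto simp: pverts_consecutive_rotational)
        then show "(x, y) \<in> (\<lambda>(x, y). (u x, u y)) ` parcs ?R"
          using e enum(2)[of i j] by (auto simp: consecutive_rotational_arc_iff intro!: image_eqI[of _ _ "(i, j)"])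
      qed (auto simp: consecutive_rotational_arc_iff enum(2))
    qed
    moreover have "wf_digraph (with_proj ?R)"
      by (auto simp: wf_digraph_def consecutive_rotational_arc_iff pverts_consecutive_rotational)
    ultimately show ?thesis using digraph_iso_swap by blast
  qed
  show ?min if ?iso
  proof (intro allI impI)
    fix T' :: "nat pair_pre_digraph" assume r: "regular_tournament (2 * m + 1) T'"
    interpret T': regular_tournament_rel "pverts T'" "?E T'" m
      using r by (rule regular_tournament_relI)
    have HT': "renyi_entropy_4 T' = h T'.closed_walks4"
      unfolding h_def K_def C_def by (rule renyi_entropy_4_regular[OF r])
    have "renyi_entropy_4 T = renyi_entropy_4 ?R"
      unfolding renyi_entropy_4_def using laplacian_spectrum_iso[OF T.finite_V that] by simp
    \<comment> \<open>The defect of \<open>?R\<close> is zero and the triangle counts agree, so only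
      the defect of \<open>T'\<close> remains.\<close>
    moreover have "3 * T'.closed_walks4 = 3 * R.closed_walks4 - 2 * T'.dominated"
      unfolding Rmax T'.closed_walks4_eq T.closed_walks3_eq T'.closed_walks3_eq
      by (simp only: right_diff_distrib)
    then have "T'.closed_walks4 \<le> R.closed_walks4" using T'.dominated_nonneg by linarith
    ultimately show "renyi_entropy_4 T \<le> renyi_entropy_4 T'"
      using h nonneg[OF r] nonneg[OF regular_consecutive_rotational] unfolding HR HT' by metis
  qed
qed

end
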